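(* For $\boldsymbol\xi=(\xi_1,\xi_2,\xi_3)\in\mathbb R^3$ consider the reduction system $u_1(\boldsymbol\xi)=u_2(\boldsymbol\xi)=0$, where $$u_1=-\cos 2\xi_1-\cos 2\xi_2-\cos(2\xi_1-2\xi_2-2\xi_3)-\cos(2\xi_1+2\xi_2-2\xi_3)+\cos 2\xi_3-\cos(2\xi_1-2\xi_2+2\xi_3),$$ $$u_2=-\sin 2\xi_1-\sin 2\xi_2+\sin(2\xi_1-2\xi_2-2\xi_3)-\sin(2\xi_1+2\xi_2-2\xi_3)+\sin 2\xi_3-\sin(2\xi_1-2\xi_2+2\xi_3).$$ Put $a=\xi_2-\xi_1$, $b=\xi_3-\xi_2$. Modulo uniform phase shifts $\boldsymbol\xi\mapsto\boldsymbol\xi+\delta(1,1,1)$, the system admits precisely three solutions $(a,b)$ modulo $\pi$ (in each entry). One is degenerate, $$(a,b)\equiv\left(0,\tfrac{\pi}{2}\right)\pmod \pi,$$ for which, taking the representative $\xi_2=\xi_1$, the three-dimensional velocity field $\boldsymbol v^0$ of the context vanishes identically. The other two are non-trivial (the velocity field $\boldsymbol v^0$ does not vanish identically), $$(a,b)\equiv\left(\tfrac{\pi}{3},-\tfrac{\pi}{6}\right)\quad\text{and}\quad (a,b)\equiv\left(-\tfrac{\pi}{3},\tfrac{\pi}{6}\right)\pmod\pi,$$ which are negatives of one another.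
   Context: The velocity field is, with $\alpha>0$, $v_r>0$, $$\frac{v_1^0(\boldsymbol x,\boldsymbol\xi)}{v_r}=\sin(\alpha x_1+\xi_1)\cos(\alpha x_2+\xi_2)\sin(\alpha x_3+\xi_3)-\sin(\alpha x_1+\xi_2)\sin(\alpha x_2+\xi_3)\cos(\alpha x_3+\xi_1),$$ with $v_2^0,v_3^0$ obtained by the cyclic coordinate permutations $(x_1,x_2,x_3)\mapsto(x_2,x_3,x_1)$ and $(x_1,x_2,x_3)\mapsto(x_3,x_1,x_2)$ with the same $\boldsymbol\xi$. The system $u_1=u_2=0$ is equivalent to the vanishing of the $x_1$-independent part of $g_1^0=\sum_j v_j^0\,\partial_j v_1^0$. It depends only on the phases modulo $\pi$, and adding $\pi$ to one phase replaces $\boldsymbol v^0$ by $-\boldsymbol v^0$. A uniform phase shift is a rigid translation of the coordinates. *)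

theory Defs
  imports "HOL-Analysis.Analysis" "HOL-Library.Real_Mod"
begin

definition v1 :: "real \<Rightarrow> real \<Rightarrow> real^3 \<Rightarrow> real \<Rightarrow> real \<Rightarrow> real \<Rightarrow> real" where
  "v1 \<alpha> vr \<xi> x y z = vr *
     (sin (\<alpha> * x + \<xi>$1) * cos (\<alpha> * y + \<xi>$2) * sin (\<alpha> * z + \<xi>$3)
    - sin (\<alpha> * x + \<xi>$2) * sin (\<alpha> * y + \<xi>$3) * cos (\<alpha> * z + \<xi>$1))"

text \<open>The second and third components are the first one with the coordinates
  cyclically permuted and the phases kept in place.\<close>

definition velocity :: "real \<Rightarrow> real \<Rightarrow> real^3 \<Rightarrow> real^3 \<Rightarrow> real^3" where
  "velocity \<alpha> vr \<xi> x = vector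
     [v1 \<alpha> vr \<xi> (x$1) (x$2) (x$3),
      v1 \<alpha> vr \<xi> (x$2) (x$3) (x$1),
      v1 \<alpha> vr \<xi> (x$3) (x$1) (x$2)]"

definition u1 :: "real^3 \<Rightarrow> real" where
  "u1 \<xi> = - cos (2 * \<xi>$1) - cos (2 * \<xi>$2)
          - cos (2 * \<xi>$1 - 2 * \<xi>$2 - 2 * \<xi>$3)
          - cos (2 * \<xi>$1 + 2 * \<xi>$2 - 2 * \<xi>$3)
          + cos (2 * \<xi>$3)
          - cos (2 * \<xi>$1 - 2 * \<xi>$2 + 2 * \<xi>$3)"

definition u2 :: "real^3 \<Rightarrow> real" where
  "u2 \<xi> = - sin (2 * \<xi>$1) - sin (2 * \<xi>$2)
          + sin (2 * \<xi>$1 - 2 * \<xi>$2 - 2 * \<xi>$3)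
          - sin (2 * \<xi>$1 + 2 * \<xi>$2 - 2 * \<xi>$3)
          + sin (2 * \<xi>$3)
          - sin (2 * \<xi>$1 - 2 * \<xi>$2 + 2 * \<xi>$3)"

definition reduction_solutions :: "(real^3) set" where
  "reduction_solutions = {\<xi>. u1 \<xi> = 0 \<and> u2 \<xi> = 0}"

text \<open>The pair \<open>(a, b)\<close>. Two phase vectors have the same pair iff they differ by a
  uniform phase shift.\<close>

definition phase_diffs :: "real^3 \<Rightarrow> real \<times> real" where
  "phase_diffs \<xi> = (\<xi>$2 - \<xi>$1, \<xi>$3 - \<xi>$2)"

definition cong_pi :: "((real \<times> real) \<times> (real \<times> real)) set" where
  "cong_pi = {(p, q). [fst p = fst q] (rmod pi) \<and> [snd p = snd q] (rmod pi)}"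

end

theory Submission
  imports Defs
begin

text \<open>
  Every angle in the reduction system has the form \<open>2 \<xi>\<^sub>i\<close> or, up to sign,
  \<open>2 \<xi>\<^sub>i + 2 \<xi>\<^sub>j - 2 \<xi>\<^sub>k\<close>, so a uniform phase shift by \<open>\<delta>\<close> multiplies the complex
  number \<open>u\<^sub>1 + \<i> u\<^sub>2\<close> by the unit \<open>exp (2 \<i> \<delta>)\<close>. Factoring out \<open>exp (2 \<i> \<xi>\<^sub>2)\<close> leaves a
  complex number \<open>- (R + \<i> I)\<close> that depends on \<open>a\<close> and \<open>b\<close> alone
  (\<open>reduction_system_rotated\<close>), and the system becomes \<open>R = I = 0\<close>. This already gives
  the invariance under uniform shifts.

  The imaginary part factors: \<open>I = - 4 cos (b - a) cos b sin a\<close>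
  (\<open>reduced_imag_factored\<close>). Hence there are three branches, and on each one \<open>R\<close> is a
  product in one variable (\<open>reduced_real_on_branches\<close>). On \<open>cos b = 0\<close> and on
  \<open>sin a = 0\<close> it is \<open>4 sin\<^sup>2 a\<close> and \<open>4 cos\<^sup>2 b\<close>, so both lead to the class of
  \<open>(0, \<pi>/2)\<close>. On \<open>cos (b - a) = 0\<close> it is a multiple of
  \<open>sin\<^sup>2 a sin (a - \<pi>/3) sin (a + \<pi>/3)\<close>; the factor \<open>sin\<^sup>2 a\<close> gives the same class again,
  and the other two give \<open>a \<equiv> \<plusminus>\<pi>/3\<close> with \<open>b \<equiv> a + \<pi>/2\<close>, that is
  \<open>b \<equiv> \<minusplus>\<pi>/6\<close>, modulo \<open>\<pi>\<close>.

  For the velocity field, \<open>a \<equiv> 0\<close> and \<open>b \<equiv> \<pi>/2\<close> make the two products in \<open>v\<^sub>1\<close> equal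
  (\<open>velocity_eq_0\<close>), while at a suitable point \<open>v\<^sub>1 = - v\<^sub>r sin a\<close>, which is nonzero for
  \<open>a \<equiv> \<plusminus>\<pi>/3\<close> (\<open>velocity_neq_0\<close>).
\<close>

section \<open>Congruence modulo \<open>\<pi>\<close>\<close>

text \<open>Writing congruences modulo \<open>\<pi>\<close> as zeros of the sine lets the addition theorems do all
  the later case analysis, with no integer multiples of \<open>\<pi>\<close> to carry along.\<close>

lemma rcong_pi_iff_sin: "[x = y] (rmod pi) \<longleftrightarrow> sin (x - y) = 0"
proof -
  have "[x = y] (rmod pi) \<longleftrightarrow> (\<exists>n. y = x + of_int n * pi)"
    by (rule rcong_altdef)
  also have "\<dots> \<longleftrightarrow> (\<exists>n::int. x - y = of_int n * pi)"
  proof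
    assume "\<exists>n::int. y = x + of_int n * pi"
    then obtain n :: int where "y = x + of_int n * pi" by blast
    then have "x - y = of_int (- n) * pi" by simp
    then show "\<exists>n::int. x - y = of_int n * pi" by blast
  next
    assume "\<exists>n::int. x - y = of_int n * pi"
    then obtain n :: int where "x - y = of_int n * pi" by blast
    then have "y = x + of_int (- n) * pi" by simp
    then show "\<exists>n::int. y = x + of_int n * pi" by blast
  qed
  also have "\<dots> \<longleftrightarrow> sin (x - y) = 0"
    by (simp add: sin_zero_iff_int2)
  finally show ?thesis .
qed

lemma cong_pi_iff_sin:
  "((a, b), (c, d)) \<in> cong_pi \<longleftrightarrow> sin (a - c) = 0 \<and> sin (b - d) = 0"
  by (simp add: cong_pi_def rcong_pi_iff_sin)

lemma equiv_cong_pi: "equiv UNIV cong_pi"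
  by (intro equivI)
    (auto simp: cong_pi_def refl_on_def sym_def intro!: transI intro: rcong_sym rcong_trans)

section \<open>Reduction to the phase differences\<close>

text \<open>The next two functions are the real and imaginary parts of
  \<open>- exp (- 2 \<i> \<xi>\<^sub>2) (u\<^sub>1 + \<i> u\<^sub>2)\<close>, written in the phase differences.\<close>

definition reduced_real :: "real \<Rightarrow> real \<Rightarrow> real" where
  "reduced_real a b = cos (2 * a) + 1 + 2 * cos (2 * a + 2 * b) - cos (2 * b) + cos (2 * b - 2 * a)"

definition reduced_imag :: "real \<Rightarrow> real \<Rightarrow> real" where
  "reduced_imag a b = sin (2 * b - 2 * a) - sin (2 * a) - sin (2 * b)"

text \<open>Substituting \<open>2 \<xi>\<^sub>1 = q - 2 a\<close> and \<open>2 \<xi>\<^sub>3 = q + 2 b\<close>, every angle is \<open>q\<close> plus or minus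
  a combination of \<open>a\<close> and \<open>b\<close>, except \<open>2 \<xi>\<^sub>1 - 2 \<xi>\<^sub>2 - 2 \<xi>\<^sub>3 = - (q + 2 a + 2 b)\<close>; that term
  has the opposite sign in \<open>u\<^sub>2\<close>, which compensates. So \<open>u\<^sub>1 + \<i> u\<^sub>2\<close> is
  \<open>- (R + \<i> I)\<close> rotated by \<open>q\<close>.\<close>

lemma reduction_system_rotated:
  fixes \<xi> :: "real^3"
  defines "a \<equiv> \<xi>$2 - \<xi>$1" and "b \<equiv> \<xi>$3 - \<xi>$2" and "q \<equiv> 2 * \<xi>$2"
  shows "u1 \<xi> = - (reduced_real a b * cos q - reduced_imag a b * sin q)"
    and "u2 \<xi> = - (reduced_real a b * sin q + reduced_imag a b * cos q)"
proof -
  define A where "A = 2 * a"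
  define B where "B = 2 * b"
  have phases: "2 * \<xi>$1 = q - A" "2 * \<xi>$2 = q" "2 * \<xi>$3 = q + B"
    by (simp_all add: A_def B_def a_def b_def q_def)
  have combs: "q - A - q - (q + B) = - (q + (A + B))" "q - A + q - (q + B) = q - (A + B)"
     "q - A - q + (q + B) = q + (B - A)"
    by simp_all
  have R: "reduced_real a b = cos A + 1 + 2 * cos (A + B) - cos B + cos (B - A)"
    and I: "reduced_imag a b = sin (B - A) - sin A - sin B"
    by (simp_all add: reduced_real_def reduced_imag_def A_def B_def)
  show "u1 \<xi> = - (reduced_real a b * cos q - reduced_imag a b * sin q)"
    unfolding u1_def R I phases combs cos_minus cos_add[of q] cos_diff[of q]
    by (simp add: algebra_simps)
  show "u2 \<xi> = - (reduced_real a b * sin q + reduced_imag a b * cos q)"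
    unfolding u2_def R I phases combs sin_minus sin_add[of q] sin_diff[of q]
    by (simp add: algebra_simps)
qed

lemma rotation_eq_0_iff:
  fixes r i t :: real
  shows "r * cos t - i * sin t = 0 \<and> r * sin t + i * cos t = 0 \<longleftrightarrow> r = 0 \<and> i = 0"
proof -
  have "(r * cos t - i * sin t)\<^sup>2 + (r * sin t + i * cos t)\<^sup>2
      = (r\<^sup>2 + i\<^sup>2) * ((sin t)\<^sup>2 + (cos t)\<^sup>2)"
    by algebra
  then have "(r * cos t - i * sin t)\<^sup>2 + (r * sin t + i * cos t)\<^sup>2 = r\<^sup>2 + i\<^sup>2"
    by simp
  then show ?thesis
    by (metis sum_power2_eq_zero_iff)
qed

lemma reduction_solutions_iff_reduced:
  "\<xi> \<in> reduction_solutions \<longleftrightarrow>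
     reduced_real (\<xi>$2 - \<xi>$1) (\<xi>$3 - \<xi>$2) = 0 \<and> reduced_imag (\<xi>$2 - \<xi>$1) (\<xi>$3 - \<xi>$2) = 0"
  unfolding reduction_solutions_def mem_Collect_eq reduction_system_rotated neg_equal_0_iff_equal
  by (rule rotation_eq_0_iff)

section \<open>Solving the reduced system\<close>

text \<open>\<open>sin (2 b - 2 a)\<close> and \<open>sin (2 a) + sin (2 b)\<close> share the factor \<open>2 cos (b - a)\<close>; what is
  left is \<open>sin (b - a) - sin (b + a)\<close>.\<close>

lemma reduced_imag_factored: "reduced_imag a b = - 4 * cos (b - a) * cos b * sin a"
proof -
  have "reduced_imag a b = 2 * sin (b - a) * cos (b - a) - 2 * sin (a + b) * cos (a - b)"
    using sin_double[of "b - a"] sin_plus_sin[of "2 * a" "2 * b"]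
    by (simp add: reduced_imag_def right_diff_distrib add_divide_distrib diff_divide_distrib)
  also have "cos (a - b) = cos (b - a)"
    by (metis cos_minus minus_diff_eq)
  finally show ?thesis
    by (simp add: sin_add sin_diff algebra_simps)
qed

text \<open>In each branch of \<open>I = 0\<close> one of \<open>2 b\<close>, \<open>2 a\<close>, \<open>2 b - 2 a\<close> has a known sine and cosine,
  so \<open>R\<close> becomes a polynomial in the sine or cosine of one angle. In the third branch it is
  \<open>2 cos (2 a) - 2 cos (4 a) = 4 sin a sin (3 a)\<close>, and the factors
  \<open>sin (a \<plusminus> \<pi>/3)\<close> come from \<open>sin (3 a)\<close>.\<close>

lemma reduced_real_on_branches:
  shows "cos b = 0 \<Longrightarrow> reduced_real a b = 4 * (sin a)\<^sup>2"
    and "sin a = 0 \<Longrightarrow> reduced_real a b = 4 * (cos b)\<^sup>2"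
    and "cos (b - a) = 0 \<Longrightarrow>
           reduced_real a b = - 16 * (sin a)\<^sup>2 * (sin (a - pi / 3) * sin (a + pi / 3))"
proof -
  assume b: "cos b = 0"
  then have "sin (2 * b) = 0" "cos (2 * b) = - 1"
    by (simp_all add: sin_double cos_double_cos)
  then show "reduced_real a b = 4 * (sin a)\<^sup>2"
    by (simp add: reduced_real_def cos_add cos_diff cos_double_sin[of a])
next
  assume "sin a = 0"
  then have "sin (2 * a) = 0" "cos (2 * a) = 1"
    by (simp_all add: sin_double cos_double_sin)
  then show "reduced_real a b = 4 * (cos b)\<^sup>2"
    by (simp add: reduced_real_def cos_add cos_diff cos_double_cos[of b])
next
  assume "cos (b - a) = 0"
  then have half_turn: "sin (2 * (b - a)) = 0" "cos (2 * (b - a)) = - 1"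
    using sin_double[of "b - a"] cos_double_cos[of "b - a"] by simp_all
  have "cos (2 * a + 2 * b) = cos (2 * (2 * a) + 2 * (b - a))"
    and "cos (2 * b) = cos (2 * a + 2 * (b - a))"
    and "cos (2 * b - 2 * a) = cos (2 * (b - a))"
    by (simp_all add: algebra_simps)
  then have "cos (2 * a + 2 * b) = - cos (2 * (2 * a))"
    and "cos (2 * b) = - cos (2 * a)" and "cos (2 * b - 2 * a) = - 1"
    by (simp_all only: cos_add half_turn)
  then have "reduced_real a b = 2 * (1 - cos (2 * a)) * (1 + 2 * cos (2 * a))"
    unfolding reduced_real_def cos_double_cos[of "2 * a"]
    by (simp add: algebra_simps power2_eq_square)
  also have "\<dots> = 4 * (sin a)\<^sup>2 * (3 - 4 * (sin a)\<^sup>2)"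
    unfolding cos_double_sin by (simp add: algebra_simps)
  also have "3 - 4 * (sin a)\<^sup>2 = - 4 * (sin (a - pi / 3) * sin (a + pi / 3))"
  proof -
    have "sin (a - pi / 3) * sin (a + pi / 3) = (sin a)\<^sup>2 / 4 - 3 / 4 * (cos a)\<^sup>2"
      by (simp add: sin_add sin_diff sin_60 cos_60 algebra_simps power2_eq_square)
    then show ?thesis
      using sin_cos_squared_add[of a] by linarith
  qed
  finally show "reduced_real a b = - 16 * (sin a)\<^sup>2 * (sin (a - pi / 3) * sin (a + pi / 3))"
    by simp
qed

text \<open>In the third branch \<open>b\<close> is determined by \<open>a\<close>: if \<open>a \<equiv> c\<close>, then \<open>cos (b - a) = 0\<close> says
  \<open>b \<equiv> c - \<pi>/2\<close> modulo \<open>\<pi>\<close>.\<close>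

lemma quadrature_iff:
  fixes a b c :: real
  assumes "sin (a - c) = 0"
  shows "cos (b - a) = 0 \<longleftrightarrow> sin (b - (c - pi / 2)) = 0"
proof -
  have "cos (a - c) \<noteq> 0"
    using assms sin_cos_squared_add[of "a - c"] by auto
  moreover have "sin (b - (c - pi / 2)) = cos ((b - a) + (a - c))"
    using sin_add[of "b - c" "pi / 2"] by (simp add: algebra_simps)
  ultimately show ?thesis
    using assms by (simp only: cos_add) simp
qed

lemma reduced_system_solutions:
  "reduced_real a b = 0 \<and> reduced_imag a b = 0 \<longleftrightarrow>
     ((a, b), (0, pi / 2)) \<in> cong_pi
   \<or> ((a, b), (pi / 3, - pi / 6)) \<in> cong_pi
   \<or> ((a, b), (- pi / 3, pi / 6)) \<in> cong_pi"
    (is "?solves \<longleftrightarrow> ?deg \<or> ?pos \<or> ?neg")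
proof -
  have deg: "?deg \<longleftrightarrow> sin a = 0 \<and> cos b = 0"
    by (simp add: cong_pi_iff_sin sin_diff)
  have pos: "?pos \<longleftrightarrow> sin (a - pi / 3) = 0 \<and> cos (b - a) = 0"
    using quadrature_iff[of a "pi / 3" b] by (auto simp: cong_pi_iff_sin)
  have neg: "?neg \<longleftrightarrow> sin (a + pi / 3) = 0 \<and> cos (b - a) = 0"
  proof -
    \<comment> \<open>\<open>- \<pi>/3 - \<pi>/2 = \<pi>/6 - \<pi>\<close>\<close>
    have "sin (b - (- pi / 3 - pi / 2)) = - sin (b - pi / 6)"
      using sin_minus_pi[of "b + 5 * pi / 6"] by (simp add: algebra_simps)
    then show ?thesis
      using quadrature_iff[of a "- pi / 3" b] by (auto simp: cong_pi_iff_sin)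
  qed
  have branches: "reduced_imag a b = 0 \<longleftrightarrow> cos (b - a) = 0 \<or> cos b = 0 \<or> sin a = 0"
    by (simp add: reduced_imag_factored)
  \<comment> \<open>The root \<open>sin a = 0\<close> of \<open>R\<close> on the branch \<open>cos (b - a) = 0\<close> gives no new class.\<close>
  have deg_branch: "cos b = 0" if "sin a = 0" "cos (b - a) = 0"
  proof -
    have "cos a \<noteq> 0"
      using that sin_cos_squared_add[of a] by auto
    then show ?thesis using that by (simp add: cos_diff)
  qed
  show ?thesis
    unfolding deg pos neg
    using reduced_real_on_branches[of b a] reduced_real_on_branches(2)[of a b] branches deg_branch
    by auto
qed

lemma reduction_solutions_iff:
  "\<xi> \<in> reduction_solutions \<longleftrightarrow>
     (phase_diffs \<xi>, (0, pi / 2)) \<in> cong_pi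
   \<or> (phase_diffs \<xi>, (pi / 3, - pi / 6)) \<in> cong_pi
   \<or> (phase_diffs \<xi>, (- pi / 3, pi / 6)) \<in> cong_pi"
  unfolding reduction_solutions_iff_reduced reduced_system_solutions phase_diffs_def ..

section \<open>Counting the classes\<close>

lemma phase_diffs_shift: "phase_diffs (\<xi> + \<delta> *\<^sub>R vector [1, 1, 1]) = phase_diffs \<xi>"
  by (simp add: phase_diffs_def)

text \<open>Surjectivity ensures that each of the three classes in the solution set is a full
  \<open>cong_pi\<close>-class of the plane.\<close>

lemma range_phase_diffs: "range phase_diffs = UNIV"
proof -
  have "p = phase_diffs (vector [0, fst p, fst p + snd p])" for p
    by (simp add: phase_diffs_def)
  then show ?thesis by blast
qed

lemma card_solution_classes: "card ((phase_diffs ` reduction_solutions) // cong_pi) = 3"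
proof -
  let ?P = "{(0, pi / 2), (pi / 3, - pi / 6), (- pi / 3, pi / 6)} :: (real \<times> real) set"
  have class_eq: "cong_pi `` {p} = cong_pi `` {q} \<longleftrightarrow> (p, q) \<in> cong_pi" for p q
    using eq_equiv_class_iff[OF equiv_cong_pi] by simp
  have sols: "phase_diffs ` reduction_solutions = {p. \<exists>q\<in>?P. (p, q) \<in> cong_pi}"
  proof (intro set_eqI iffI)
    fix p assume "p \<in> phase_diffs ` reduction_solutions"
    then show "p \<in> {p. \<exists>q\<in>?P. (p, q) \<in> cong_pi}"
      using reduction_solutions_iff by auto
  next
    fix p assume p: "p \<in> {p. \<exists>q\<in>?P. (p, q) \<in> cong_pi}"
    obtain \<xi> where "p = phase_diffs \<xi>"
      using range_phase_diffs by (metis surjD)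
    with p show "p \<in> phase_diffs ` reduction_solutions"
      using reduction_solutions_iff by auto
  qed
  have refl: "(p, p) \<in> cong_pi" for p
    using class_eq[of p p] by simp
  have "(phase_diffs ` reduction_solutions) // cong_pi = (\<lambda>q. cong_pi `` {q}) ` ?P"
  proof (intro set_eqI iffI)
    fix C assume "C \<in> (phase_diffs ` reduction_solutions) // cong_pi"
    then obtain p q where "C = cong_pi `` {p}" "q \<in> ?P" "(p, q) \<in> cong_pi"
      unfolding sols by (elim quotientE) blast
    then show "C \<in> (\<lambda>q. cong_pi `` {q}) ` ?P"
      using class_eq by blast
  next
    fix C assume "C \<in> (\<lambda>q. cong_pi `` {q}) ` ?P"
    then obtain q where "q \<in> ?P" "C = cong_pi `` {q}" by blast
    then show "C \<in> (phase_diffs ` reduction_solutions) // cong_pi"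
      unfolding sols using refl by (blast intro: quotientI)
  qed
  moreover have "inj_on (\<lambda>q. cong_pi `` {q}) ?P"
  proof -
    \<comment> \<open>The first entries \<open>0, \<pi>/3, - \<pi>/3\<close> are already incongruent modulo \<open>\<pi>\<close>.\<close>
    have "sin (pi / 3) \<noteq> 0" "sin (2 * pi / 3) \<noteq> 0"
      by (simp_all add: sin_60 sin_120)
    moreover have "sin (- (2 * pi / 3)) = - sin (2 * pi / 3)" "- pi / 3 - pi / 3 = - (2 * pi / 3)"
      "pi / 3 - - pi / 3 = 2 * pi / 3"
      by (simp_all only: sin_minus)
    ultimately show ?thesis
      by (auto simp only: inj_on_def class_eq cong_pi_iff_sin insert_iff empty_iff) simp_all
  qed
  moreover have "card ?P = 3"
    by simp
  ultimately show ?thesis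
    by (simp only: card_image)
qed

section \<open>The velocity field on the solutions\<close>

text \<open>With \<open>sin a = cos b = 0\<close>, trading \<open>\<xi>\<^sub>2\<close> for \<open>\<xi>\<^sub>1\<close> costs the sign \<open>cos a\<close>, and trading
  \<open>\<xi>\<^sub>3\<close> for \<open>\<xi>\<^sub>1\<close> turns a sine into \<open>cos a sin b\<close> times a cosine. Both products in \<open>v\<^sub>1\<close>
  then are the same multiple of
  \<open>sin (\<alpha> x + \<xi>\<^sub>1) cos (\<alpha> y + \<xi>\<^sub>1) cos (\<alpha> z + \<xi>\<^sub>1)\<close>.\<close>

lemma velocity_eq_0:
  assumes "(phase_diffs \<xi>, (0, pi / 2)) \<in> cong_pi"
  shows "velocity \<alpha> vr \<xi> x = 0"
proof -
  let ?a = "\<xi>$2 - \<xi>$1" and ?b = "\<xi>$3 - \<xi>$2"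
  have a: "sin ?a = 0" and b: "cos ?b = 0"
    using assms by (simp_all add: phase_diffs_def cong_pi_iff_sin sin_diff[of _ "pi / 2"])
  have second: "sin (t + \<xi>$2) = cos ?a * sin (t + \<xi>$1)" "cos (t + \<xi>$2) = cos ?a * cos (t + \<xi>$1)"
    for t
    using sin_add[of "t + \<xi>$1" ?a] cos_add[of "t + \<xi>$1" ?a] a by simp_all
  have third: "sin (t + \<xi>$3) = cos ?a * sin ?b * cos (t + \<xi>$1)" for t
    using sin_add[of "t + \<xi>$2" ?b] b second[of t] by simp
  have "v1 \<alpha> vr \<xi> X Y Z = 0" for X Y Z
    unfolding v1_def second third by simp
  then show ?thesis
    by (simp add: velocity_def vec_eq_iff forall_3)
qed

text \<open>The witness makes \<open>\<alpha> x\<^sub>1 + \<xi>\<^sub>1 = \<alpha> x\<^sub>3 + \<xi>\<^sub>1 = 0\<close> and \<open>\<alpha> x\<^sub>2 + \<xi>\<^sub>3 = \<pi>/2\<close>: the first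
  product in \<open>v\<^sub>1\<close> vanishes and the second reduces to its factor \<open>sin (\<alpha> x\<^sub>1 + \<xi>\<^sub>2) = sin a\<close>.\<close>

lemma velocity_neq_0:
  assumes "\<alpha> \<noteq> 0" and "vr \<noteq> 0" and "sin (\<xi>$2 - \<xi>$1) \<noteq> 0"
  shows "\<exists>x. velocity \<alpha> vr \<xi> x \<noteq> 0"
proof -
  let ?x = "vector [- \<xi>$1 / \<alpha>, (pi / 2 - \<xi>$3) / \<alpha>, - \<xi>$1 / \<alpha>] :: real^3"
  have "velocity \<alpha> vr \<xi> ?x $ 1 = - vr * sin (\<xi>$2 - \<xi>$1)"
    using assms(1) by (simp add: velocity_def v1_def)
  then have "velocity \<alpha> vr \<xi> ?x $ 1 \<noteq> 0"
    using assms by simp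
  then show ?thesis by (metis zero_index)
qed

section \<open>The solutions of the reduction system\<close>

theorem proposition4p1:
  fixes \<alpha> vr :: real
  assumes "\<alpha> > 0" and "vr > 0"
  shows "(\<forall>\<xi> \<delta>. \<xi> + \<delta> *\<^sub>R vector [1, 1, 1] \<in> reduction_solutions \<longleftrightarrow> \<xi> \<in> reduction_solutions)
    \<and> (\<forall>\<xi>. \<xi> \<in> reduction_solutions \<longleftrightarrow>
          (phase_diffs \<xi>, (0, pi / 2)) \<in> cong_pi
        \<or> (phase_diffs \<xi>, (pi / 3, - pi / 6)) \<in> cong_pi
        \<or> (phase_diffs \<xi>, (- pi / 3, pi / 6)) \<in> cong_pi)
    \<and> card ((phase_diffs ` reduction_solutions) // cong_pi) = 3
    \<and> (\<forall>\<xi>. (phase_diffs \<xi>, (0, pi / 2)) \<in> cong_pi \<longrightarrow> (\<forall>x. velocity \<alpha> vr \<xi> x = 0))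
    \<and> (\<forall>\<xi>. (phase_diffs \<xi>, (pi / 3, - pi / 6)) \<in> cong_pi \<longrightarrow> (\<exists>x. velocity \<alpha> vr \<xi> x \<noteq> 0))
    \<and> (\<forall>\<xi>. (phase_diffs \<xi>, (- pi / 3, pi / 6)) \<in> cong_pi \<longrightarrow> (\<exists>x. velocity \<alpha> vr \<xi> x \<noteq> 0))
    \<and> (- pi / 3, pi / 6) = - (pi / 3, - pi / 6)"
proof (intro conjI allI impI)
  \<comment> \<open>Used with \<open>c = \<plusminus>\<pi>/3\<close>: whether \<open>sin a\<close> vanishes depends only on \<open>a\<close> modulo \<open>\<pi>\<close>.\<close>
  have no_zero: "sin a \<noteq> 0" if "sin (a - c) = 0" "sin c \<noteq> 0" for a c :: real
  proof
    assume "sin a = 0"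
    then have "cos a \<noteq> 0"
      using sin_cos_squared_add[of a] by auto
    with that \<open>sin a = 0\<close> show False by (simp add: sin_diff)
  qed
  show "\<xi> + \<delta> *\<^sub>R vector [1, 1, 1] \<in> reduction_solutions \<longleftrightarrow> \<xi> \<in> reduction_solutions" for \<xi> \<delta>
    by (simp only: reduction_solutions_iff phase_diffs_shift)
  show "\<xi> \<in> reduction_solutions \<longleftrightarrow>
      (phase_diffs \<xi>, (0, pi / 2)) \<in> cong_pi
    \<or> (phase_diffs \<xi>, (pi / 3, - pi / 6)) \<in> cong_pi
    \<or> (phase_diffs \<xi>, (- pi / 3, pi / 6)) \<in> cong_pi" for \<xi>
    by (rule reduction_solutions_iff)
  show "card ((phase_diffs ` reduction_solutions) // cong_pi) = 3"
    by (rule card_solution_classes)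
  show "velocity \<alpha> vr \<xi> x = 0" if "(phase_diffs \<xi>, (0, pi / 2)) \<in> cong_pi" for \<xi> x
    using that by (rule velocity_eq_0)
  show "\<exists>x. velocity \<alpha> vr \<xi> x \<noteq> 0" if "(phase_diffs \<xi>, (pi / 3, - pi / 6)) \<in> cong_pi" for \<xi>
    using that assms no_zero[of "\<xi>$2 - \<xi>$1" "pi / 3"]
    by (intro velocity_neq_0) (auto simp: phase_diffs_def cong_pi_iff_sin sin_60)
  show "\<exists>x. velocity \<alpha> vr \<xi> x \<noteq> 0" if "(phase_diffs \<xi>, (- pi / 3, pi / 6)) \<in> cong_pi" for \<xi>
    using that assms no_zero[of "\<xi>$2 - \<xi>$1" "- pi / 3"]
    by (intro velocity_neq_0) (auto simp: phase_diffs_def cong_pi_iff_sin sin_60)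
  show "(- pi / 3, pi / 6) = - (pi / 3, - pi / 6)"
    by simp
qed

end
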